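(* Let $D$ be a digraph of order $n$ and let $k$ be an integer with $2\leq k\leq n$. Then: (i) if $n\geq \kappa(D)+k$, then $\kappa^p_k(D)\leq \kappa(D)$; (ii) $\kappa^p_k(D)\leq \lambda(D)$.
   Context: $\kappa(D)$ is the vertex-strong connectivity of $D$ and $\lambda(D)$ its arc-strong connectivity. For $S\subseteq V(D)$ with $|S|\geq 2$ and $r\in S$, an $(S,r)$-path is a directed path $P$ starting at $r$ with $S\subseteq V(P)$; two $(S,r)$-paths are internally disjoint if they share no arc and their common vertex set is exactly $S$. $\kappa^p_{S,r}(D)$ is the maximum number of pairwise internally disjoint $(S,r)$-paths in $D$, and $\kappa^p_k(D)=\min\{\kappa^p_{S,r}(D)\mid S\subseteq V(D),|S|=k,r\in S\}$. *)

theory Defs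
  imports "Graph_Theory.Graph_Theory"
begin

definition k_strong :: "('a, 'b) pre_digraph \<Rightarrow> nat \<Rightarrow> bool" where
  "k_strong D k \<longleftrightarrow> k + 1 \<le> card (verts D) \<and>
     (\<forall>X. X \<subseteq> verts D \<and> card X < k \<longrightarrow> strongly_connected (D \<restriction> (verts D - X)))"

(* By the order bound in k_strong, the complete digraph on n vertices has value n - 1,
   and a digraph that is not strong has value 0. *)
definition vertex_strong_connectivity :: "('a, 'b) pre_digraph \<Rightarrow> nat" where
  "vertex_strong_connectivity D = Max {k. k_strong D k}"

definition del_arcs :: "('a, 'b) pre_digraph \<Rightarrow> 'b set \<Rightarrow> ('a, 'b) pre_digraph" where
  "del_arcs D W = D\<lparr>arcs := arcs D - W\<rparr>"

definition k_arc_strong :: "('a, 'b) pre_digraph \<Rightarrow> nat \<Rightarrow> bool" where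
  "k_arc_strong D k \<longleftrightarrow>
     (\<forall>W. W \<subseteq> arcs D \<and> card W < k \<longrightarrow> strongly_connected (del_arcs D W))"

(* The set below is bounded for finite digraphs with at least two vertices; on a single
   vertex every k qualifies and the value is unspecified. *)
definition arc_strong_connectivity :: "('a, 'b) pre_digraph \<Rightarrow> nat" where
  "arc_strong_connectivity D = Max {k. k_arc_strong D k}"

(* Paths are represented by their lists of arcs; the start vertex is r. *)
definition SR_paths :: "('a, 'b) pre_digraph \<Rightarrow> 'a set \<Rightarrow> 'a \<Rightarrow> 'b list set" where
  "SR_paths D S r =
     {p. \<exists>v. pre_digraph.apath D r p v \<and> S \<subseteq> set (pre_digraph.awalk_verts D r p)}"

definition internally_disjoint ::
  "('a, 'b) pre_digraph \<Rightarrow> 'a set \<Rightarrow> 'a \<Rightarrow> 'b list \<Rightarrow> 'b list \<Rightarrow> bool" where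
  "internally_disjoint D S r p q \<longleftrightarrow>
     set p \<inter> set q = {} \<and>
     set (pre_digraph.awalk_verts D r p) \<inter> set (pre_digraph.awalk_verts D r q) = S"

definition path_connectivity_at :: "('a, 'b) pre_digraph \<Rightarrow> 'a set \<Rightarrow> 'a \<Rightarrow> nat" where
  "path_connectivity_at D S r =
     Max {card P | P. P \<subseteq> SR_paths D S r \<and> pairwise (internally_disjoint D S r) P}"

definition path_connectivity :: "('a, 'b) pre_digraph \<Rightarrow> nat \<Rightarrow> nat" where
  "path_connectivity D k =
     Min {path_connectivity_at D S r | S r. S \<subseteq> verts D \<and> card S = k \<and> r \<in> S}"

end

theory Submission
  imports Defs
begin

text \<open>
  By maximality of the connectivity, some set \<open>C\<close> of at most \<open>\<kappa>(D)\<close> vertices (respectively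
  \<open>\<lambda>(D)\<close> arcs) leaves two vertices \<open>u\<close>, \<open>v\<close> such that \<open>v\<close> is not reachable from \<open>u\<close> once \<open>C\<close> is
  deleted. Choose \<open>S\<close> of size \<open>k\<close> containing \<open>u\<close> and \<open>v\<close>; in the vertex case \<open>S\<close> is chosen to
  avoid \<open>C\<close>, which is possible because \<open>n \<ge> \<kappa>(D) + k\<close>. Every \<open>(S, u)\<close>-path meets \<open>C\<close>, and
  internally disjoint ones meet it in disjoint sets, so there are at most \<open>card C\<close> of them.
\<close>

text \<open>Picking one point of \<open>f p \<inter> C\<close> for each \<open>p\<close> is
  injective, because these traces on \<open>C\<close> are pairwise disjoint.\<close>

lemma card_le_card_transversal:
  assumes "finite C"
    and hit: "\<And>p. p \<in> P \<Longrightarrow> f p \<inter> C \<noteq> {}"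
    and disj: "\<And>p q. p \<in> P \<Longrightarrow> q \<in> P \<Longrightarrow> p \<noteq> q \<Longrightarrow> f p \<inter> f q \<inter> C = {}"
  shows "card P \<le> card C"
proof -
  have "\<forall>p\<in>P. \<exists>x. x \<in> f p \<inter> C"
    using hit by blast
  then obtain g where g: "\<And>p. p \<in> P \<Longrightarrow> g p \<in> f p \<inter> C"
    by metis
  have "inj_on g P"
  proof (rule inj_onI, rule ccontr)
    fix p q assume "p \<in> P" "q \<in> P" "g p = g q" "p \<noteq> q"
    with g[of p] g[of q] disj[of p q] show False by auto
  qed
  with g \<open>finite C\<close> show ?thesis
    by (intro card_inj_on_le[of g]) auto
qed

text \<open>Shared by both bounds: \<open>f p\<close> will be the vertex set of \<open>p\<close> or
  its arc set. Disjointness is asked only inside \<open>C\<close>, since internally disjoint paths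
  have the vertices of \<open>S\<close> in common.\<close>

lemma path_connectivity_le_card_cut:
  assumes "finite (verts D)" "S \<subseteq> verts D" "card S = k" "r \<in> S" "finite C"
    and hit: "\<And>p. p \<in> SR_paths D S r \<Longrightarrow> f p \<inter> C \<noteq> {}"
    and disj: "\<And>p q. internally_disjoint D S r p q \<Longrightarrow> f p \<inter> f q \<inter> C = {}"
  shows "path_connectivity D k \<le> card C"
proof -
  let ?N = "{card P | P. P \<subseteq> SR_paths D S r \<and> pairwise (internally_disjoint D S r) P}"
  let ?M = "{path_connectivity_at D S r | S r. S \<subseteq> verts D \<and> card S = k \<and> r \<in> S}"
  have bound: "card P \<le> card C"
    if "P \<subseteq> SR_paths D S r" "pairwise (internally_disjoint D S r) P" for P
    using that \<open>finite C\<close> hit disj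
    by (intro card_le_card_transversal[of C P f]) (auto simp: pairwise_def)
  then have "finite ?N"
    by (intro finite_subset[of ?N "{..card C}"]) auto
  \<comment> \<open>The empty family makes \<open>?N\<close> nonempty, so that \<open>Max\<close>
    can be bounded elementwise.\<close>
  moreover have "card {} \<in> ?N"
    by (auto intro!: exI[of _ "{}"])
  ultimately have at: "path_connectivity_at D S r \<le> card C"
    unfolding path_connectivity_at_def using bound by (subst Max_le_iff) blast+
  have "?M \<subseteq> (\<lambda>(S, r). path_connectivity_at D S r) ` (Pow (verts D) \<times> verts D)"
    by force
  then have "finite ?M"
    by (rule finite_subset) (simp add: \<open>finite (verts D)\<close>)
  then have "path_connectivity D k \<le> path_connectivity_at D S r"
    unfolding path_connectivity_def using assms(2-4) by (intro Min_le) blast+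
  with at show ?thesis by simp
qed

text \<open>A subgraph keeps tails and heads, so \<open>p\<close> is also a walk of \<open>H\<close>
  with the same vertices; its part up to \<open>w\<close> witnesses reachability.\<close>

lemma (in wf_digraph) reachable_in_subgraph_if_on_awalk:
  assumes "subgraph H G" "awalk u p v" "u \<in> verts H" "set p \<subseteq> arcs H"
    and w: "w \<in> set (awalk_verts u p)"
  shows "u \<rightarrow>\<^sup>*\<^bsub>H\<^esub> w"
proof -
  interpret H: wf_digraph H
    using \<open>subgraph H G\<close> by blast
  have compat: "compatible G H"
    using \<open>subgraph H G\<close> by (auto simp: subgraph_def compatible_def)
  have "H.cas u p v"
    using \<open>awalk u p v\<close> compatible_cas[OF compat] by (auto simp: awalk_def)
  then have "H.awalk u p v"
    using assms(3,4) by (simp add: H.awalk_def)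
  moreover have "w \<in> set (H.awalk_verts u p)"
    using w compatible_awalk_verts[OF compat] by simp
  ultimately show ?thesis
    by (metis H.awalk_decomp H.reachable_awalk)
qed

lemma exists_subset_card_containing_pair:
  assumes "finite A" "u \<in> A" "v \<in> A" "2 \<le> k" "k \<le> card A"
  obtains S where "u \<in> S" "v \<in> S" "S \<subseteq> A" "card S = k"
proof -
  \<comment> \<open>Only an upper bound, as \<open>u\<close> and \<open>v\<close> may
    coincide.\<close>
  have "card {u, v} \<le> k"
    using card_insert_le_m1[of 2 "{v}" u] \<open>2 \<le> k\<close> by simp
  then obtain S where "{u, v} \<subseteq> S" "S \<subseteq> A" "card S = k"
    using assms exists_subset_between[of "{u, v}" k A] by auto
  with that show ?thesis by auto
qed

context fin_digraph
begin

text \<open>\<open>k_strong\<close> fails at the successor of the maximum. The hypothesis keeps its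
  order bound true there, so the failure comes from a cut; complete digraphs, which have no cut, are
  thereby excluded.\<close>

lemma exists_minimum_vertex_cut:
  assumes "vertex_strong_connectivity G + 2 \<le> card (verts G)"
  obtains X where "X \<subseteq> verts G" "card X \<le> vertex_strong_connectivity G"
    "\<not> strongly_connected (G \<restriction> (verts G - X))"
proof -
  let ?\<kappa> = "vertex_strong_connectivity G"
  have "finite {k. k_strong G k}"
    by (rule finite_subset[of _ "{..card (verts G)}"]) (auto simp: k_strong_def)
  then have "\<not> k_strong G (Suc ?\<kappa>)"
    unfolding vertex_strong_connectivity_def by (metis Max_ge mem_Collect_eq not_less_eq_eq order_refl)
  with assms that show ?thesis
    by (auto simp: k_strong_def less_Suc_eq_le)
qed

lemma exists_minimum_arc_cut:
  assumes "2 \<le> card (verts G)"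
  obtains W where "W \<subseteq> arcs G" "card W \<le> arc_strong_connectivity G"
    "\<not> strongly_connected (del_arcs G W)"
proof -
  let ?l = "arc_strong_connectivity G"
  obtain u v where "u \<in> verts G" "v \<in> verts G" "u \<noteq> v"
    using assms by (metis card_le_Suc0_iff_eq finite_verts not_less_eq_eq numeral_2_eq_2)
  \<comment> \<open>Deleting every arc separates two distinct vertices, so the admissible
    \<open>k\<close> are bounded by the number of arcs and \<open>Max\<close> is taken over a finite
    set.\<close>
  then have no: "\<not> strongly_connected (del_arcs G (arcs G))"
    by (auto simp: strongly_connected_def del_arcs_def reachable_def arcs_ends_def
        elim: rtrancl_on.cases)
  have "k \<le> card (arcs G)" if "k_arc_strong G k" for k
    using that no unfolding k_arc_strong_def by (auto simp: not_less[symmetric])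
  then have "finite {k. k_arc_strong G k}"
    by (auto intro: finite_subset[of "{k. k_arc_strong G k}" "{..card (arcs G)}"])
  then have "\<not> k_arc_strong G (Suc ?l)"
    unfolding arc_strong_connectivity_def by (metis Max_ge mem_Collect_eq not_less_eq_eq order_refl)
  with that show ?thesis
    by (auto simp: k_arc_strong_def less_Suc_eq_le)
qed

lemma path_connectivity_le_vertex_strong_connectivity:
  assumes "2 \<le> k" and n: "vertex_strong_connectivity G + k \<le> card (verts G)"
  shows "path_connectivity G k \<le> vertex_strong_connectivity G"
proof -
  obtain X where X: "X \<subseteq> verts G" "card X \<le> vertex_strong_connectivity G"
    and nsc: "\<not> strongly_connected (G \<restriction> (verts G - X))"
    using assms by (elim exists_minimum_vertex_cut[rotated]) linarith
  let ?H = "G \<restriction> (verts G - X)"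
  have fX: "finite X"
    using X(1) by (rule finite_subset) simp
  then have k: "k \<le> card (verts G - X)"
    using X n by (simp add: card_Diff_subset)
  with \<open>2 \<le> k\<close> have "verts G - X \<noteq> {}" by (metis card.empty not_numeral_le_zero order_trans)
  \<comment> \<open>\<open>strongly_connected\<close> also demands a nonempty vertex set; once that
    is secured, its failure yields an unreachable pair.\<close>
  with nsc obtain u v where uv: "u \<in> verts G - X" "v \<in> verts G - X" "\<not> u \<rightarrow>\<^sup>*\<^bsub>?H\<^esub> v"
    by (auto simp: strongly_connected_def)
  obtain S where S: "u \<in> S" "v \<in> S" "S \<subseteq> verts G - X" "card S = k"
    using exists_subset_card_containing_pair[OF _ uv(1,2) \<open>2 \<le> k\<close> k] by auto
  have "set (awalk_verts u p) \<inter> X \<noteq> {}" if SR: "p \<in> SR_paths G S u" for p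
  proof
    assume avoid: "set (awalk_verts u p) \<inter> X = {}"
    obtain w where p: "awalk u p w" "S \<subseteq> set (awalk_verts u p)"
      using SR by (auto simp: SR_paths_def apath_def)
    have "set p \<subseteq> arcs G"
      using p(1) by auto
    \<comment> \<open>Both ends of every arc of \<open>p\<close> are vertices of \<open>p\<close>,
      so a path that misses \<open>X\<close> keeps all its arcs in the induced subgraph.\<close>
    then have "set p \<subseteq> arcs ?H"
      using avoid awalk_verts_arc1[of _ p u] awalk_verts_arc2[OF p(1)] by auto
    moreover have "subgraph ?H G"
      by (simp add: induced_imp_subgraph induced_induce)
    ultimately show False
      using reachable_in_subgraph_if_on_awalk[of ?H u p w v] p S uv by auto
  qed
  \<comment> \<open>Internally disjoint paths meet exactly in \<open>S\<close>, which lies outside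
    \<open>X\<close>, so they share no vertex of \<open>X\<close>.\<close>
  then have "path_connectivity G k \<le> card X"
    using S fX
    by (intro path_connectivity_le_card_cut[of _ S k u X "\<lambda>p. set (awalk_verts u p)"])
      (auto simp: internally_disjoint_def)
  with X show ?thesis by simp
qed

lemma path_connectivity_le_arc_strong_connectivity:
  assumes "2 \<le> k" "k \<le> card (verts G)"
  shows "path_connectivity G k \<le> arc_strong_connectivity G"
proof -
  obtain W where W: "W \<subseteq> arcs G" "card W \<le> arc_strong_connectivity G"
    and nsc: "\<not> strongly_connected (del_arcs G W)"
    using assms by (elim exists_minimum_arc_cut[rotated]) linarith
  let ?H = "del_arcs G W"
  have "verts G \<noteq> {}" using assms by auto
  with nsc obtain u v where uv: "u \<in> verts G" "v \<in> verts G" "\<not> u \<rightarrow>\<^sup>*\<^bsub>?H\<^esub> v"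
    by (auto simp: strongly_connected_def del_arcs_def)
  obtain S where S: "u \<in> S" "v \<in> S" "S \<subseteq> verts G" "card S = k"
    using exists_subset_card_containing_pair[OF finite_verts uv(1,2) assms] by auto
  have "set p \<inter> W \<noteq> {}" if SR: "p \<in> SR_paths G S u" for p
  proof
    assume avoid: "set p \<inter> W = {}"
    obtain w where p: "awalk u p w" "S \<subseteq> set (awalk_verts u p)"
      using SR by (auto simp: SR_paths_def apath_def)
    have "set p \<subseteq> arcs ?H" "u \<in> verts ?H"
      using p(1) avoid uv by (auto simp: del_arcs_def)
    moreover have "subgraph ?H G"
      by (auto simp: subgraph_def del_arcs_def compatible_def wf_digraph_def intro: wellformed)
    ultimately show False
      using reachable_in_subgraph_if_on_awalk[of ?H u p w v] p S uv by auto
  qed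
  \<comment> \<open>Internally disjoint paths share no arc at all, so here \<open>S\<close> can be
    any \<open>k\<close>-set of vertices containing \<open>u\<close> and \<open>v\<close>.\<close>
  then have "path_connectivity G k \<le> card W"
    using S finite_subset[OF W(1) finite_arcs]
    by (intro path_connectivity_le_card_cut[of _ S k u W set])
      (auto simp: internally_disjoint_def)
  with W show ?thesis by simp
qed

end

theorem theorem3p3:
  fixes D :: "('a, 'b) pre_digraph" and n k :: nat
  assumes "digraph D"
    and "card (verts D) = n"
    and "2 \<le> k" and "k \<le> n"
  shows "(n \<ge> vertex_strong_connectivity D + k
            \<longrightarrow> path_connectivity D k \<le> vertex_strong_connectivity D)
       \<and> path_connectivity D k \<le> arc_strong_connectivity D"
proof -
  interpret digraph D by fact
  show ?thesis
    using assms(2-4) path_connectivity_le_vertex_strong_connectivity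
      path_connectivity_le_arc_strong_connectivity by auto
qed

end
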